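(* Let $\ell\in\mathbb{N}$, let $\mathfrak{g}^{(\ell)}_{n}:=\sqrt{n}\prod_{j=1}^{\ell-1}(n-j)$ for $n\geq0$ and $\mathfrak{g}^{(\ell)}_{n}:=0$ for $n<0$, and let $\rho_{n}^{(\ell)}:=(-\Delta)^{\ell}\mathfrak{g}_{n}^{(\ell)}/\mathfrak{g}_{n}^{(\ell)}$ for $n\geq\ell$. (i) The sequence $\rho^{(\ell)}$ admits the convergent series expansion $$\rho_{n}^{(\ell)}=\frac{n^{\ell-1}}{(n-1)\dots(n-\ell+1)}\sum_{k=2\ell}^{\infty}\frac{r_{k}^{(\ell)}}{n^{k}}$$ for all $n\geq\ell$, where $$r_{k}^{(\ell)}=\sum_{m=2\ell}^{k}\binom{\ell+m-k-1/2}{m}\,s(\ell,\ell+m-k)\,X_{m}^{(\ell)}.$$ In particular, $$r_{2\ell}^{(\ell)}=\left(\frac{1}{2}\right)_{\ell}^{2}\quad\text{and}\quad r_{2\ell+1}^{(\ell)}=\frac{\ell(\ell-1)(2\ell+1)}{2(2\ell-1)}\left(\frac{1}{2}\right)_{\ell}^{2}.$$ (ii) If $\ell\geq2$, then $r_{k}^{(\ell)}>0$ for all $k\geq2\ell$. (If $\ell=1$, then $r_{2k+1}^{(1)}=0$ and $r_{2k}^{(1)}>0$ for all $k\geq1$.) (iii) If $\ell\geq2$, then for all $n\geq\ell$, $$\rho_{n}^{(\ell)}>\frac{(-\Delta)^{\ell}n^{\ell-1/2}}{n^{\ell-1/2}}>\left(\frac{1}{2}\right)_{\ell}^{2}\f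rac{1}{n^{2\ell}}.$$
   Context: $\mathbb{N}=\{1,2,\dots\}$. The discrete Laplacian acts on sequences by $(\Delta u)_{n}:=u_{n-1}-2u_{n}+u_{n+1}$, and $(-\Delta)^{\ell}u_n$ means $((-\Delta)^{\ell}u)_n=\sum_{j=-\ell}^{\ell}\binom{2\ell}{\ell+j}(-1)^{j}u_{n+j}$; in particular $(-\Delta)^{\ell}n^{\nu}=\sum_{j=-\ell}^{\ell}\binom{2\ell}{\ell+j}(-1)^{j}(n+j)^{\nu}$. For $\nu\in\mathbb{R}$ and $n\in\mathbb{N}_0$: $\binom{\nu}{n}:=\frac{\nu(\nu-1)\dots(\nu-n+1)}{n!}$ and $(\nu)_{n}:=\nu(\nu+1)\dots(\nu+n-1)$ (Pochhammer symbol; $(\nu)_n^2$ is its square). Empty products equal $1$. Stirling numbers of the first kind: $s(n,k):=(-1)^{n+k}\sum_{1\leq i_{1}<\dots<i_{n-k}<n}i_{1}i_{2}\dots i_{n-k}$ for $n\in\mathbb{N}$, $0\leq k<n$; $s(n,n):=1$; and $s(n,k):=0$ for $k<0$. For $m,\ell\in\mathbb{N}$: $X_{m}^{(\ell)}:=\sum_{j=-\ell}^{\ell}\binom{2\ell}{\ell+j}(-1)^{j}j^{m}$. *)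

theory Defs
  imports Complex_Main
begin

text \<open>
  Sequences are indexed by integers, so that \<open>u (n + j)\<close> makes sense for negative indices too.
\<close>

definition laplacian :: "(int \<Rightarrow> real) \<Rightarrow> int \<Rightarrow> real" where
  "laplacian u n = u (n - 1) - 2 * u n + u (n + 1)"

definition neg_laplacian_pow :: "nat \<Rightarrow> (int \<Rightarrow> real) \<Rightarrow> int \<Rightarrow> real" where
  "neg_laplacian_pow l u n =
     (\<Sum>j = - int l..int l. real (2 * l choose nat (int l + j)) * (-1) powi j * u (n + j))"

text \<open>The explicit formula above is the \<open>l\<close>-th iterate of the negative Laplacian.\<close>

lemma forward_difference_funpow:
  fixes u :: "int \<Rightarrow> real"
  shows "((\<lambda>v n. v n - v (n + 1)) ^^ k) u n
           = (\<Sum>i\<le>k. (-1) ^ i * real (k choose i) * u (n + int i))"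
proof (induction k arbitrary: n)
  case 0
  then show ?case by simp
next
  case (Suc k)
  let ?f = "\<lambda>i. (-1) ^ i * real (k choose i) * u (n + int i)"
  let ?g = "\<lambda>i. (-1) ^ i * real (k choose i) * u (n + 1 + int i)"
  have "((\<lambda>v n. v n - v (n + 1)) ^^ Suc k) u n = (\<Sum>i\<le>k. ?f i) - (\<Sum>i\<le>k. ?g i)"
    by (simp add: Suc.IH)
  also have "(\<Sum>i\<le>k. ?f i) = (\<Sum>i\<le>Suc k. ?f i)"
    by simp
  also have "\<dots> = ?f 0 + (\<Sum>i\<le>k. ?f (Suc i))"
    by (rule sum.atMost_Suc_shift)
  also have "?f 0 + (\<Sum>i\<le>k. ?f (Suc i)) - (\<Sum>i\<le>k. ?g i)
      = u n + (\<Sum>i\<le>k. ?f (Suc i) - ?g i)"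
    by (simp add: sum_subtractf)
  also have "(\<Sum>i\<le>k. ?f (Suc i) - ?g i)
      = (\<Sum>i\<le>k. (-1) ^ Suc i * real (Suc k choose Suc i) * u (n + int (Suc i)))"
    by (intro sum.cong) (auto simp: algebra_simps)
  also have "u n + \<dots> = (\<Sum>i\<le>Suc k. (-1) ^ i * real (Suc k choose i) * u (n + int i))"
    by (subst sum.atMost_Suc_shift) simp
  finally show ?case .
qed

lemma neg_laplacian_funpow:
  "((\<lambda>v n. - laplacian v n) ^^ l) u n
     = (-1) ^ l * ((\<lambda>v n. v n - v (n + 1)) ^^ (2 * l)) u (n - int l)"
proof (induction l arbitrary: n)
  case 0
  then show ?case by simp
next
  case (Suc l)
  have shift: "n - 1 - int l = n - int (Suc l)" "n - int l = n - int (Suc l) + 1"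
    "n + 1 - int l = n - int (Suc l) + 1 + 1"
    by auto
  have "((\<lambda>v n. - laplacian v n) ^^ Suc l) u n
      = - laplacian (((\<lambda>v n. - laplacian v n) ^^ l) u) n"
    by simp
  also have "\<dots> = (-1) ^ Suc l * ((\<lambda>v n. v n - v (n + 1)) ^^ (2 * Suc l)) u (n - int (Suc l))"
    unfolding laplacian_def[of _ n] Suc.IH shift by (simp add: algebra_simps)
  finally show ?case .
qed

lemma neg_laplacian_pow_eq_funpow:
  "neg_laplacian_pow l u = ((\<lambda>v n. - laplacian v n) ^^ l) u"
proof
  fix n
  have "neg_laplacian_pow l u n
      = (\<Sum>i\<le>2 * l. (-1) ^ l * ((-1) ^ i * real (2 * l choose i) * u (n - int l + int i)))"
    unfolding neg_laplacian_pow_def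
    by (rule sum.reindex_bij_witness[of _ "\<lambda>i. int i - int l" "\<lambda>j. nat (int l + j)"])
       (auto simp: power_int_def uminus_power_if nat_add_distrib
          minus_one_power_iff even_nat_iff algebra_simps)
  also have "\<dots> = ((\<lambda>v n. - laplacian v n) ^^ l) u n"
    by (simp add: neg_laplacian_funpow forward_difference_funpow sum_distrib_left)
  finally show "neg_laplacian_pow l u n = ((\<lambda>v n. - laplacian v n) ^^ l) u n" .
qed

text \<open>
  Signed Stirling numbers of the first kind: for \<open>0 \<le> k < n\<close> the sum ranges over
  \<open>1 \<le> i\<^sub>1 < \<dots> < i\<^bsub>n-k\<^esub> < n\<close>, encoded as the \<open>(n - k)\<close>-element subsets of \<open>{1..<n}\<close>.
  The value for \<open>k > n\<close> is set to 0.
\<close>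

definition stirling_first :: "nat \<Rightarrow> int \<Rightarrow> int" where
  "stirling_first n k =
     (if k < 0 \<or> k > int n then 0
      else if k = int n then 1
      else (-1) ^ (n + nat k) *
        (\<Sum>I | I \<subseteq> {1..<n} \<and> card I = n - nat k. \<Prod>i\<in>I. int i))"

definition X_coeff :: "nat \<Rightarrow> nat \<Rightarrow> real" where
  "X_coeff l m =
     (\<Sum>j = - int l..int l. real (2 * l choose nat (int l + j)) * (-1) powi j * real_of_int j ^ m)"

definition g_seq :: "nat \<Rightarrow> int \<Rightarrow> real" where
  "g_seq l n =
     (if n < 0 then 0 else sqrt (real_of_int n) * (\<Prod>j = 1..l - 1. real_of_int n - real j))"

definition rho :: "nat \<Rightarrow> nat \<Rightarrow> real" where
  "rho l n = neg_laplacian_pow l (g_seq l) (int n) / g_seq l (int n)"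

definition r_coeff :: "nat \<Rightarrow> nat \<Rightarrow> real" where
  "r_coeff l k =
     (\<Sum>m = 2 * l..k. ((real l + real m - real k - 1 / 2) gchoose m)
        * of_int (stirling_first l (int l + int m - int k)) * X_coeff l m)"

end

theory Submission
  imports Defs "HOL-Analysis.Generalised_Binomial_Theorem"
begin

text \<open>
  Write \<open>s\<^sub>p\<close> for the Stirling number \<open>s(l, l - p)\<close>. The product defining the
  sequence \<open>g\<close> is, up to the factor \<open>1/x\<close>, a falling factorial, so
  \<open>g(x) = (\<Sum>p<l. s\<^sub>p * x powr (l - p - 1/2))\<close> for all integers \<open>x \<ge> 0\<close>
  (lemma \<open>g_seq_eq_powr_sum\<close>). The exponents are positive half-integers. For a single
  exponent \<open>a > 0\<close> the \<open>l\<close>-fold negative Laplacian of \<open>n powr a\<close>, divided by \<open>n powr a\<close>, equals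
  \<open>(\<Sum>m. (a gchoose m) * X_coeff l m / n ^ m)\<close>: expand the last factor in
  \<open>(n + j) powr a = n powr a * (1 + j/n) powr a\<close> by the binomial series
  (lemma \<open>neg_laplacian_pow_powr_sums\<close>).
  For \<open>n = l\<close> the extreme arguments are \<open>j/n = 1\<close> and \<open>j/n = -1\<close>, which is why the binomial
  series is needed on the closed interval. Adding up over \<open>p\<close> and collecting powers of \<open>n\<close>
  gives the expansion, and exhibits \<open>r\<^sub>k\<close> as the sum of the terms
  \<open>r_term l p (k - p)\<close> over \<open>p < l\<close>.

  Everything else rests on one sign computation (lemma \<open>r_term_pos\<close>): each of these terms is
  positive when \<open>k - p\<close> is even and at least \<open>2 * l\<close>, and it vanishes otherwise.
  Indeed, the moment \<open>X\<^sub>m\<close> vanishes for odd \<open>m\<close> and for \<open>m < 2 * l\<close>, and has sign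
  \<open>(-1) ^ l\<close> for the other \<open>m\<close>; the Stirling number has sign \<open>(-1) ^ p\<close>; and of the \<open>m\<close>
  factors in the numerator of the binomial coefficient of \<open>l - p - 1/2\<close> exactly
  \<open>m - (l - p)\<close> are negative. For \<open>l \<ge> 2\<close> one of \<open>p = 0\<close> and \<open>p = 1\<close> has the right parity, so
  \<open>r\<^sub>k > 0\<close>. The terms with \<open>p = 0\<close> are exactly the expansion of the ratio for
  the pure power \<open>n powr (l - 1/2)\<close>. Hence dropping all other terms, together with the prefactor,
  which exceeds 1, bounds \<open>\<rho>\<close> strictly from below by that ratio, and dropping in turn all but the
  leading term gives the second inequality.
\<close>

section \<open>The binomial series on the closed unit interval\<close>

text \<open>
  The identity \<open>(m + 1) * (a gchoose (m + 1)) = (a - m) * (a gchoose m)\<close> shows that, once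
  \<open>m \<ge> a\<close>, the quantity \<open>a * \<bar>a gchoose m\<bar>\<close> is the decrement of the nonnegative sequence
  \<open>m * \<bar>a gchoose m\<bar>\<close>. So that sequence decreases, hence converges, and the series telescopes.
\<close>

lemma summable_abs_gbinomial:
  fixes a :: real
  assumes "a > 0"
  shows "summable (\<lambda>m. \<bar>a gchoose m\<bar>)"
proof -
  define d where "d m = real m * \<bar>a gchoose m\<bar>" for m
  define N where "N = nat \<lceil>a\<rceil>"
  have N: "a \<le> real m" if "m \<ge> N" for m
    using that unfolding N_def by linarith
  have step: "d m - d (Suc m) = a * \<bar>a gchoose m\<bar>" if "m \<ge> N" for m
  proof -
    have "real (Suc m) * (a gchoose Suc m) = (a - real m) * (a gchoose m)"
      using gbinomial_mult_1[of a m] by (simp add: algebra_simps)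
    then have "d (Suc m) = \<bar>a - real m\<bar> * \<bar>a gchoose m\<bar>"
      unfolding d_def by (metis abs_mult abs_of_nat)
    also have "\<bar>a - real m\<bar> = real m - a"
      using N[OF that] by simp
    finally show ?thesis
      by (simp add: d_def algebra_simps)
  qed
  have "decseq (\<lambda>m. d (m + N))"
  proof (rule decseq_SucI)
    show "d (Suc m + N) \<le> d (m + N)" for m
      using step[of "m + N"] assms by (smt (verit) abs_ge_zero add_Suc le_add2 mult_nonneg_nonneg)
  qed
  then obtain L where "(\<lambda>m. d (m + N)) \<longlonglongrightarrow> L"
    by (rule decseq_convergent[of _ 0]) (auto simp: d_def)
  then have "summable (\<lambda>m. d (m + N) - d (Suc m + N))"
    using telescope_summable'[of "\<lambda>m. d (m + N)"] by simp
  also have "(\<lambda>m. d (m + N) - d (Suc m + N)) = (\<lambda>m. a * \<bar>a gchoose (m + N)\<bar>)"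
    using step by simp
  finally have "summable (\<lambda>m. \<bar>a gchoose (m + N)\<bar>)"
    using assms by (simp add: summable_cmult_iff)
  then show ?thesis
    by (subst (asm) summable_iff_shift)
qed

text \<open>
  Absolute summability of the coefficients makes the partial sums converge uniformly on \<open>[-1, 1]\<close>,
  so both sides are continuous there; they agree in the interior by the binomial theorem.
  Positivity of \<open>a\<close> also makes \<open>0 powr a = 0\<close> the correct value at \<open>x = -1\<close>.
\<close>

lemma binomial_series_closed_interval:
  fixes a x :: real
  assumes "a > 0" and "\<bar>x\<bar> \<le> 1"
  shows "(\<lambda>m. (a gchoose m) * x ^ m) sums (1 + x) powr a"
proof -
  define F where "F y = (\<Sum>m. (a gchoose m) * y ^ m)" for y :: real
  have bound: "norm ((a gchoose m) * y ^ m) \<le> \<bar>a gchoose m\<bar>" if "y \<in> {-1..1}" for m and y :: real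
    using that by (auto simp: abs_mult power_abs intro!: mult_left_le power_le_one)
  have "uniform_limit {-1..1} (\<lambda>n y. \<Sum>m<n. (a gchoose m) * y ^ m) F sequentially"
    unfolding F_def
    by (rule Weierstrass_m_test[OF bound summable_abs_gbinomial[OF assms(1)]])
  then have "continuous_on {-1..1} F"
    by (rule uniform_limit_theorem[rotated]) (auto intro!: always_eventually continuous_intros)
  moreover have "continuous_on {-1..1} (\<lambda>y. (1 + y) powr a)"
    using assms(1) by (intro continuous_on_powr' continuous_intros) auto
  ultimately have "continuous_on (closure {-1<..<1}) (\<lambda>y. F y - (1 + y) powr a)"
    by (simp add: continuous_on_diff)
  moreover have "F y - (1 + y) powr a = 0" if "y \<in> {-1<..<1}" for y
    using gen_binomial_real[of y a] that by (auto simp: F_def sums_iff abs_less_iff)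
  moreover have "x \<in> closure {-1<..<1}"
    using assms(2) by auto
  ultimately have "F x - (1 + x) powr a = 0"
    by (rule continuous_constant_on_closure)
  moreover have "summable (\<lambda>m. (a gchoose m) * x ^ m)"
    by (rule summable_comparison_test'[OF summable_abs_gbinomial[OF assms(1)], of 0], rule bound)
      (use assms(2) in auto)
  ultimately show ?thesis
    by (simp add: F_def sums_iff)
qed

text \<open>
  In \<open>(q - 1/2)(q - 3/2)\<dots>(q - m + 1/2)\<close> the first \<open>q\<close> factors descend to \<open>1/2\<close>; the remaining
  \<open>m - q\<close> factors are \<open>-1/2, -3/2, \<dots>\<close>. Both the sign of the coefficient and the closed form of
  the leading coefficients come from this splitting.
\<close>

lemma gbinomial_half_integer:
  assumes "q \<le> m"
  shows "((real q - 1 / 2) gchoose m) * fact m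
    = (-1) ^ (m - q) * (pochhammer (1 / 2) q * pochhammer (1 / 2) (m - q))"
  using assms
proof (induction m rule: dec_induct)
  case base
  show ?case
    by (simp add: gbinomial_pochhammer')
next
  case (step m)
  let ?a = "real q - 1 / 2"
  have "(?a gchoose Suc m) * fact (Suc m) = (?a - real m) * ((?a gchoose m) * fact m)"
    using gbinomial_mult_1[of ?a m] by (simp add: algebra_simps)
  also have "\<dots> = (?a - real m)
      * ((-1) ^ (m - q) * (pochhammer (1 / 2) q * pochhammer (1 / 2) (m - q)))"
    by (simp only: step.IH)
  finally show ?case
    using step.hyps by (simp add: Suc_diff_le pochhammer_Suc of_nat_diff algebra_simps)
qed

section \<open>The moments of the coefficients of the Laplacian power\<close>

lemma X_coeff_eq_neg_laplacian_pow: "X_coeff l m = neg_laplacian_pow l (\<lambda>x. real_of_int x ^ m) 0"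
  by (simp add: X_coeff_def neg_laplacian_pow_def)

lemma neg_laplacian_pow_sum:
  "neg_laplacian_pow l (\<lambda>x. \<Sum>i\<in>A. c i * u i x) n = (\<Sum>i\<in>A. c i * neg_laplacian_pow l (u i) n)"
  unfolding neg_laplacian_pow_def sum_distrib_left
  by (subst sum.swap) (simp add: mult_ac)

text \<open>
  The moment is the value at 0 of the \<open>l\<close>-fold negative Laplacian of \<open>x ^ m\<close>. Applying one
  Laplacian first and expanding \<open>(x + 1) ^ m + (x - 1) ^ m - 2 * x ^ m\<close> leaves lower powers of
  \<open>x\<close> with nonnegative coefficients, which vanish for odd \<open>k\<close>. Each Laplacian thus removes an even
  number, at least 2, of powers and contributes one factor \<open>-1\<close>; vanishing and signs of the moments
  follow by induction.
\<close>

lemma X_coeff_Suc: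
  "X_coeff (Suc l) m = - (\<Sum>k = 1..m. real (m choose k) * (1 + (-1) ^ k) * X_coeff l (m - k))"
proof -
  let ?c = "\<lambda>k. - (real (m choose k) * (1 + (-1) ^ k))"
  have "- laplacian (\<lambda>x. real_of_int x ^ m) x = (\<Sum>k = 1..m. ?c k * real_of_int x ^ (m - k))" for x
  proof -
    have "(1 + real_of_int x) ^ m + (-1 + real_of_int x) ^ m
        = (\<Sum>k\<le>m. real (m choose k) * (1 + (-1) ^ k) * real_of_int x ^ (m - k))"
      unfolding binomial_ring sum.distrib[symmetric]
      by (intro sum.cong refl) (simp add: algebra_simps)
    also have "\<dots> = 2 * real_of_int x ^ m
        + (\<Sum>k = 1..m. real (m choose k) * (1 + (-1) ^ k) * real_of_int x ^ (m - k))"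
      by (simp add: atMost_atLeast0 sum.atLeast_Suc_atMost)
    finally have "- laplacian (\<lambda>x. real_of_int x ^ m) x
        = - (\<Sum>k = 1..m. real (m choose k) * (1 + (-1) ^ k) * real_of_int x ^ (m - k))"
      by (simp add: laplacian_def algebra_simps)
    then show ?thesis
      by (simp add: sum_negf)
  qed
  then have "neg_laplacian_pow (Suc l) (\<lambda>x. real_of_int x ^ m) 0
      = neg_laplacian_pow l (\<lambda>x. \<Sum>k = 1..m. ?c k * real_of_int x ^ (m - k)) 0"
    by (simp add: neg_laplacian_pow_eq_funpow funpow_swap1 del: funpow.simps(2))
       (simp add: funpow_Suc_right del: funpow.simps(2))
  then have "X_coeff (Suc l) m = (\<Sum>k = 1..m. ?c k * X_coeff l (m - k))"
    by (simp only: X_coeff_eq_neg_laplacian_pow neg_laplacian_pow_sum)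
  then show ?thesis
    by (simp add: sum_negf)
qed

lemma X_coeff_0: "X_coeff 0 m = (if m = 0 then 1 else 0)"
  by (simp add: X_coeff_def)

lemma X_coeff_odd_eq_0: "odd m \<Longrightarrow> X_coeff l m = 0"
proof (induction l arbitrary: m)
  case 0
  then show ?case by (cases "m = 0") (auto simp: X_coeff_0)
next
  case (Suc l)
  have "(1 + (-1) ^ k) * X_coeff l (m - k) = 0" if "k \<le> m" for k
    using Suc that by (cases "even k") auto
  then show ?case
    unfolding X_coeff_Suc by (auto simp: mult.assoc intro!: sum.neutral)
qed

lemma X_coeff_small_eq_0: "m < 2 * l \<Longrightarrow> X_coeff l m = 0"
proof (induction l arbitrary: m)
  case (Suc l)
  have "(1 + (-1) ^ k) * X_coeff l (m - k) = 0" if "1 \<le> k" "k \<le> m" for k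
  proof (cases "k = 1")
    case False
    then have "m - k < 2 * l"
      using that Suc.prems by auto
    then show ?thesis
      by (simp add: Suc.IH)
  qed auto
  then show ?case
    unfolding X_coeff_Suc by (auto simp: mult.assoc intro!: sum.neutral)
qed simp

lemma X_coeff_double: "X_coeff l (2 * l) = (-1) ^ l * fact (2 * l)"
proof (induction l)
  case 0
  then show ?case by (simp add: X_coeff_0)
next
  case (Suc l)
  let ?m = "2 * Suc l"
  let ?f = "\<lambda>k. real (?m choose k) * (1 + (-1) ^ k) * X_coeff l (?m - k)"
  have "?f k = 0" if "k \<in> {1..?m} - {2}" for k
  proof (cases "k = 1")
    case False
    then have "?m - k < 2 * l"
      using that by auto
    then show ?thesis
      by (simp add: X_coeff_small_eq_0)
  qed auto
  then have "(\<Sum>k = 1..?m. ?f k) = (\<Sum>k\<in>{2}. ?f k)"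
    by (intro sum.mono_neutral_right) auto
  also have "\<dots> = real ?m * real (?m - 1) * X_coeff l (2 * l)"
    by (simp add: choose_two real_of_nat_div algebra_simps)
  finally have "X_coeff (Suc l) ?m = - (real ?m * real (?m - 1) * ((-1) ^ l * fact (2 * l)))"
    by (simp only: X_coeff_Suc Suc.IH)
  then show ?case
    by (simp add: algebra_simps)
qed

lemma X_coeff_sign: "(-1) ^ l * X_coeff l m \<ge> 0"
proof (induction l arbitrary: m)
  case 0
  then show ?case by (simp add: X_coeff_0)
next
  case (Suc l)
  have "(-1) ^ Suc l * X_coeff (Suc l) m
      = (\<Sum>k = 1..m. real (m choose k) * (1 + (-1) ^ k) * ((-1) ^ l * X_coeff l (m - k)))"
    by (simp add: X_coeff_Suc sum_distrib_left sum_negf mult_ac)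
  also have "\<dots> \<ge> 0"
    by (rule sum_nonneg, rule mult_nonneg_nonneg[OF _ Suc.IH]) (simp add: minus_one_power_iff)
  finally show ?case .
qed

text \<open>
  In the recursion all summands have the same sign, so it suffices that the one with
  \<open>m - k = 2 * (l - 1)\<close>, whose moment is known explicitly, does not vanish.
\<close>

lemma X_coeff_sign_strict:
  assumes "l \<ge> 1" "even m" "m \<ge> 2 * l"
  shows "(-1) ^ l * X_coeff l m > 0"
proof -
  obtain k where l: "l = Suc k"
    using assms(1) by (cases l) auto
  let ?f = "\<lambda>i. real (m choose i) * (1 + (-1) ^ i) * ((-1) ^ k * X_coeff k (m - i))"
  have "(-1) ^ l * X_coeff l m = (\<Sum>i = 1..m. ?f i)"
    by (simp add: l X_coeff_Suc sum_distrib_left sum_negf mult_ac)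
  moreover have "?f (m - 2 * k) > 0"
    using assms by (simp add: l X_coeff_double)
  moreover have "?f i \<ge> 0" for i
    by (rule mult_nonneg_nonneg[OF _ X_coeff_sign]) (simp add: minus_one_power_iff)
  moreover have "m - 2 * k \<in> {1..m}"
    using assms by (simp add: l)
  ultimately show ?thesis
    using sum_pos2[of "{1..m}" "m - 2 * k" ?f] by (simp only: finite_atLeastAtMost)
qed

section \<open>Stirling numbers as elementary symmetric functions\<close>

lemma stirling_first_diff:
  assumes "p \<le> l"
  shows "stirling_first l (int l - int p)
    = (-1) ^ p * (\<Sum>I | I \<subseteq> {1..<l} \<and> card I = p. \<Prod>i\<in>I. int i)"
proof (cases "p = 0")
  case True
  have "{I. I \<subseteq> {1..<l} \<and> card I = 0} = {{}}"
    by (auto dest: finite_subset)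
  then show ?thesis
    using True by (simp add: stirling_first_def)
next
  case False
  have [simp]: "nat (int l - int p) = l - p" "l - (l - p) = p"
    using assms by auto
  have "(-1 :: int) ^ (l + (l - p)) = (-1) ^ p"
    using assms by (auto simp: minus_one_power_iff)
  then show ?thesis
    using False assms by (simp add: stirling_first_def)
qed

lemma stirling_first_sign:
  assumes "p < l"
  shows "(-1) ^ p * stirling_first l (int l - int p) > 0"
proof -
  let ?A = "{I. I \<subseteq> {1..<l} \<and> card I = p}"
  have "{1..p} \<in> ?A"
    using assms by auto
  moreover have "finite ?A"
    by (rule finite_subset[of _ "Pow {1..<l}"]) auto
  moreover have "(\<Prod>i\<in>I. int i) > 0" if "I \<in> ?A" for I
    using that by (intro prod_pos) auto
  ultimately have "(\<Sum>I\<in>?A. \<Prod>i\<in>I. int i) > 0"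
    by (intro sum_pos) auto
  then show ?thesis
    using assms by (simp add: stirling_first_diff)
qed

lemma stirling_first_0: "l \<ge> 1 \<Longrightarrow> stirling_first l 0 = 0"
proof -
  assume "l \<ge> 1"
  have "card I < l" if "I \<subseteq> {1..<l}" for I
    using card_mono[OF _ that] \<open>l \<ge> 1\<close> by simp
  then have none: "{I. I \<subseteq> {1..<l} \<and> card I = l} = {}"
    by auto
  have "stirling_first l (int l - int l) = 0"
    unfolding stirling_first_diff[OF order_refl] none by simp
  then show ?thesis
    by simp
qed

lemma stirling_first_pred:
  assumes "l \<ge> 1"
  shows "real_of_int (stirling_first l (int l - 1)) = - (real l * (real l - 1) / 2)"
proof -
  have "{I. I \<subseteq> {1..<l} \<and> card I = 1} = (\<lambda>i. {i}) ` {1..<l}"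
    by (auto simp: card_1_singleton_iff)
  then have "(\<Sum>I | I \<subseteq> {1..<l} \<and> card I = 1. \<Prod>i\<in>I. int i) = (\<Sum>i = 1..<l. int i)"
    by (simp add: sum.reindex)
  moreover have "(\<Sum>i = 1..<l. real i) = real l * (real l - 1) / 2"
    by (induction l) (auto simp: field_simps)
  ultimately show ?thesis
    using stirling_first_diff[of 1 l] assms
    by simp
qed

text \<open>
  Vieta's formula: expand the product over subsets and collect the subsets by cardinality.
\<close>

lemma prod_diff_eq_stirling_sum:
  assumes "l \<ge> 1"
  shows "(\<Prod>j = 1..l - 1. x - real j)
    = (\<Sum>p<l. of_int (stirling_first l (int l - int p)) * x ^ (l - 1 - p))"
proof -
  have interval: "{1..<l} = {1..l - 1}"
    using assms by auto
  have "(\<Prod>j = 1..l - 1. x - real j) = (\<Prod>j\<in>{1..<l}. - real j + x)"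
    unfolding interval by simp
  also have "\<dots> = (\<Sum>I\<in>Pow {1..<l}. (\<Prod>j\<in>I. - real j) * (\<Prod>j\<in>{1..<l} - I. x))"
    by (rule prod_add) simp
  also have "\<dots> = (\<Sum>p<l. \<Sum>I\<in>{I \<in> Pow {1..<l}. card I = p}. (\<Prod>j\<in>I. - real j) * (\<Prod>j\<in>{1..<l} - I. x))"
  proof (rule sum.group[symmetric])
    have "card I < l" if "I \<subseteq> {1..<l}" for I
      using card_mono[OF _ that] assms by simp
    then show "card ` Pow {1..<l} \<subseteq> {..<l}"
      by auto
  qed auto
  also have "\<dots> = (\<Sum>p<l. of_int (stirling_first l (int l - int p)) * x ^ (l - 1 - p))"
  proof (rule sum.cong[OF refl])
    fix p assume "p \<in> {..<l}"
    have "(\<Sum>I\<in>{I \<in> Pow {1..<l}. card I = p}. (\<Prod>j\<in>I. - real j) * (\<Prod>j\<in>{1..<l} - I. x))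
        = (\<Sum>I | I \<subseteq> {1..<l} \<and> card I = p. (-1) ^ p * (\<Prod>j\<in>I. real j) * x ^ (l - 1 - p))"
      by (rule sum.cong) (auto simp: prod_uminus card_Diff_subset finite_subset)
    then show "(\<Sum>I\<in>{I \<in> Pow {1..<l}. card I = p}. (\<Prod>j\<in>I. - real j) * (\<Prod>j\<in>{1..<l} - I. x))
        = of_int (stirling_first l (int l - int p)) * x ^ (l - 1 - p)"
      using \<open>p \<in> {..<l}\<close> by (simp add: stirling_first_diff sum_distrib_left sum_distrib_right)
  qed
  finally show ?thesis .
qed

section \<open>The coefficients of the expansion\<close>

text \<open>
  The summand of \<open>r_coeff l k\<close> with \<open>p = k - m\<close>. For fixed \<open>p\<close> the Stirling factor and the upper
  argument of the binomial coefficient are constant, so that, as \<open>m\<close> varies, these are the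
  coefficients of a binomial expansion in \<open>1/n\<close>.
\<close>

definition r_term :: "nat \<Rightarrow> nat \<Rightarrow> nat \<Rightarrow> real" where
  "r_term l p m = ((real l - real p - 1 / 2) gchoose m)
     * of_int (stirling_first l (int l - int p)) * X_coeff l m"

lemma r_term_eq_0: "odd m \<or> m < 2 * l \<Longrightarrow> r_term l p m = 0"
  by (auto simp: r_term_def X_coeff_odd_eq_0 X_coeff_small_eq_0)

text \<open>
  Substituting \<open>m = k - p\<close>; the ranges can be exchanged because the Stirling numbers vanish for
  \<open>p \<ge> l\<close> and the moments for \<open>k - p < 2 * l\<close>. With the range of \<open>p\<close> independent of \<open>k\<close>, the sum
  over \<open>k\<close> can be interchanged with the sum over \<open>p\<close>.
\<close>

lemma r_coeff_eq_sum_r_term: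
  assumes "l \<ge> 1"
  shows "r_coeff l k = (\<Sum>p<l. if p \<le> k then r_term l p (k - p) else 0)"
proof -
  let ?M = "{m \<in> {2 * l..k}. k < m + l}" and ?P = "{p \<in> {..<l}. p + 2 * l \<le> k}"
  let ?f = "\<lambda>m. ((real l + real m - real k - 1 / 2) gchoose m)
        * of_int (stirling_first l (int l + int m - int k)) * X_coeff l m"
  have "stirling_first l (int l + int m - int k) = 0" if "m \<in> {2 * l..k} - ?M" for m
  proof (cases "k = m + l")
    case True
    then show ?thesis
      using assms by (simp add: stirling_first_0)
  next
    case False
    then have "int l + int m - int k < 0"
      using that by auto
    then show ?thesis
      by (simp add: stirling_first_def)
  qed
  then have "r_coeff l k = (\<Sum>m\<in>?M. ?f m)"
    unfolding r_coeff_def by (intro sum.mono_neutral_right) auto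
  also have "\<dots> = (\<Sum>p\<in>?P. r_term l p (k - p))"
    by (rule sum.reindex_bij_witness[of _ "\<lambda>p. k - p" "\<lambda>m. k - m"])
      (auto simp: r_term_def of_nat_diff algebra_simps)
  also have "\<dots> = (\<Sum>p\<in>?P. if p \<le> k then r_term l p (k - p) else 0)"
    by (rule sum.cong) auto
  also have "\<dots> = (\<Sum>p<l. if p \<le> k then r_term l p (k - p) else 0)"
  proof (rule sum.mono_neutral_left)
    show "\<forall>p\<in>{..<l} - ?P. (if p \<le> k then r_term l p (k - p) else 0) = 0"
      by (auto intro!: r_term_eq_0)
  qed auto
  finally show ?thesis .
qed

text \<open>
  With \<open>q = l - p\<close>, the three factors have signs \<open>(-1) ^ (m - q)\<close>, \<open>(-1) ^ p\<close> and
  \<open>(-1) ^ l\<close>, and the sum of these exponents is \<open>m + 2 * p\<close>, which is even.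
\<close>

lemma r_term_pos:
  assumes "p < l" "even m" "m \<ge> 2 * l"
  shows "r_term l p m > 0"
proof -
  define q where "q = l - p"
  let ?s = "real_of_int (stirling_first l (int l - int p))"
  have q: "q \<le> m" "real l - real p = real q" "l = p + q"
    using assms by (auto simp: q_def)
  have "(-1) ^ (m - q) * (((real q - 1 / 2) gchoose m) * fact m)
      = pochhammer (1 / 2) q * pochhammer (1 / 2) (m - q)"
    by (simp add: gbinomial_half_integer[OF q(1)])
  also have "\<dots> > 0"
    by (intro mult_pos_pos pochhammer_pos) auto
  finally have "((-1) ^ (m - q) * ((real q - 1 / 2) gchoose m)) * fact m > 0"
    by (simp only: mult.assoc)
  then have gbinomial: "(-1) ^ (m - q) * ((real q - 1 / 2) gchoose m) > 0"
    by (rule zero_less_mult_pos2) simp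
  have stirling: "(-1) ^ p * ?s > 0"
  proof -
    have "real_of_int ((-1) ^ p * stirling_first l (int l - int p)) > 0"
      using stirling_first_sign[OF assms(1)] by (simp only: of_int_0_less_iff)
    then show ?thesis by simp
  qed
  have moment: "(-1) ^ l * X_coeff l m > 0"
    using assms by (intro X_coeff_sign_strict) auto
  have "((-1) ^ (m - q) * ((real q - 1 / 2) gchoose m)) * ((-1) ^ p * ?s)
      * ((-1) ^ l * X_coeff l m) > 0"
    by (rule mult_pos_pos[OF mult_pos_pos[OF gbinomial stirling] moment])
  also have "((-1) ^ (m - q) * ((real q - 1 / 2) gchoose m)) * ((-1) ^ p * ?s)
      * ((-1) ^ l * X_coeff l m) = ((-1) ^ (m - q) * (-1) ^ p * (-1) ^ l) * r_term l p m"
    by (simp add: r_term_def q(2))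
  also have "(-1 :: real) ^ (m - q) * (-1) ^ p * (-1) ^ l = 1"
    using assms(2) q by (auto simp: minus_one_power_iff)
  finally show ?thesis by simp
qed

lemma r_term_nonneg: "p < l \<Longrightarrow> r_term l p m \<ge> 0"
  using r_term_pos[of p l m] r_term_eq_0[of m l p] by fastforce

lemma r_term_le_r_coeff:
  assumes "p < l" "p \<le> k"
  shows "r_term l p (k - p) \<le> r_coeff l k"
proof -
  have "l \<ge> 1"
    using assms by simp
  have "(\<Sum>i\<in>{p}. if i \<le> k then r_term l i (k - i) else 0) \<le> r_coeff l k"
    unfolding r_coeff_eq_sum_r_term[OF \<open>l \<ge> 1\<close>] using assms by (intro sum_mono2) (auto intro: r_term_nonneg)
  then show ?thesis
    using assms by simp
qed

text \<open>
  All summands are nonnegative, so one positive summand suffices: \<open>p = 0\<close> for even \<open>k\<close> and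
  \<open>p = 1\<close> for odd \<open>k\<close>. The latter is available precisely when \<open>l \<ge> 2\<close>.
\<close>

lemma r_coeff_pos:
  assumes "l \<ge> 2" "k \<ge> 2 * l"
  shows "r_coeff l k > 0"
proof (cases "even k")
  case True
  then show ?thesis
    using r_term_pos[of 0 l k] r_term_le_r_coeff[of 0 l k] assms by simp
next
  case False
  then have "k \<noteq> 2 * l"
    by auto
  then have "2 * l \<le> k - 1"
    using assms by simp
  then show ?thesis
    using False r_term_pos[of 1 l "k - 1"] r_term_le_r_coeff[of 1 l k] assms by simp
qed

lemma r_coeff_one: "r_coeff 1 k = r_term 1 0 k"
  by (simp add: r_coeff_eq_sum_r_term)

lemma r_term_leading: "r_term l 0 (2 * l) = (pochhammer (1 / 2) l)\<^sup>2"
proof -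
  have "r_term l 0 (2 * l) = (-1) ^ l * (((real l - 1 / 2) gchoose (2 * l)) * fact (2 * l))"
    by (simp add: r_term_def X_coeff_double stirling_first_def)
  then show ?thesis
    by (subst (asm) gbinomial_half_integer)
      (simp_all add: power2_eq_square mult_2)
qed

lemma r_term_subleading:
  assumes "l \<ge> 1"
  shows "r_term l 1 (2 * l) =
    real l * (real l - 1) * (2 * real l + 1) / (2 * (2 * real l - 1)) * (pochhammer (1 / 2) l)\<^sup>2"
proof -
  obtain q where l: "l = Suc q"
    using assms by (cases l) auto
  let ?P = "pochhammer (1 / 2 :: real)"
  have "r_term l 1 (2 * l) = - (real l * (real l - 1) / 2) * (-1) ^ l
      * (((real q - 1 / 2) gchoose (2 * l)) * fact (2 * l))"
  proof -
    have "real l - real 1 - 1 / 2 = real q - 1 / 2"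
      by (simp add: l)
    then show ?thesis
      unfolding r_term_def X_coeff_double using stirling_first_pred[OF assms] by simp
  qed
  also have "((real q - 1 / 2) gchoose (2 * l)) * fact (2 * l)
      = (-1) ^ Suc l * (?P q * ?P (Suc l))"
    by (subst gbinomial_half_integer) (simp_all add: l)
  also have "?P q * ?P (Suc l) = (?P l)\<^sup>2 * (2 * real l + 1) / (2 * real l - 1)"
    by (simp add: l pochhammer_Suc power2_eq_square field_simps)
  finally show ?thesis
    by simp
qed

lemma r_coeff_leading: "l \<ge> 1 \<Longrightarrow> r_coeff l (2 * l) = (pochhammer (1 / 2) l)\<^sup>2"
  by (subst r_coeff_eq_sum_r_term, simp)
     (subst sum.remove[of _ 0], auto simp: r_term_eq_0 r_term_leading intro!: sum.neutral)

text \<open>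
  For \<open>k = 2 * l + 1\<close> the summand \<open>p = 0\<close> contains a moment of odd index and those with \<open>p \<ge> 2\<close>
  contain moments of index below \<open>2 * l\<close>, so only \<open>p = 1\<close> survives. For \<open>l = 1\<close> this index lies outside the range, which is
  consistent because the factor \<open>l - 1\<close> on the right then vanishes.
\<close>

lemma r_coeff_subleading:
  assumes "l \<ge> 1"
  shows "r_coeff l (2 * l + 1) =
    real l * (real l - 1) * (2 * real l + 1) / (2 * (2 * real l - 1)) * (pochhammer (1 / 2) l)\<^sup>2"
proof -
  have "r_coeff l (2 * l + 1) = (\<Sum>p<l. if p = 1 then r_term l 1 (2 * l) else 0)"
    unfolding r_coeff_eq_sum_r_term[OF assms]
  proof (rule sum.cong[OF refl])
    fix p :: nat
    have "p = 0 \<or> p = 1 \<or> p \<ge> 2"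
      by auto
    then show "(if p \<le> 2 * l + 1 then r_term l p (2 * l + 1 - p) else 0)
        = (if p = 1 then r_term l 1 (2 * l) else 0)"
      by (elim disjE) (auto simp: r_term_eq_0[OF disjI1] intro!: r_term_eq_0[OF disjI2])
  qed
  also have "\<dots> = (if l = 1 then 0 else r_term l 1 (2 * l))"
    using assms by simp
  also have "\<dots> = r_term l 1 (2 * l)"
    using r_term_subleading[of l] by auto
  finally show ?thesis
    by (simp only: r_term_subleading[OF assms])
qed

section \<open>The expansion of the ratio\<close>

lemma neg_laplacian_pow_powr_sums:
  assumes "a > 0" "1 \<le> n" "l \<le> n"
  shows "(\<lambda>m. (a gchoose m) * X_coeff l m / real n ^ m)
    sums (neg_laplacian_pow l (\<lambda>i. real_of_int i powr a) (int n) / real n powr a)"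
proof -
  let ?c = "\<lambda>j. real (2 * l choose nat (int l + j)) * (-1) powi j"
  have "(\<lambda>m. \<Sum>j = - int l..int l. ?c j * ((a gchoose m) * (of_int j / real n) ^ m))
      sums (\<Sum>j = - int l..int l. ?c j * (1 + of_int j / real n) powr a)"
    using assms by (intro sums_sum sums_mult binomial_series_closed_interval) auto
  also have "(\<lambda>m. \<Sum>j = - int l..int l. ?c j * ((a gchoose m) * (of_int j / real n) ^ m))
      = (\<lambda>m. (a gchoose m) * X_coeff l m / real n ^ m)"
    by (simp add: X_coeff_def sum_distrib_left sum_divide_distrib power_divide mult_ac)
  also have "(\<Sum>j = - int l..int l. ?c j * (1 + of_int j / real n) powr a)
      = neg_laplacian_pow l (\<lambda>i. real_of_int i powr a) (int n) / real n powr a"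
    unfolding neg_laplacian_pow_def sum_divide_distrib
  proof (rule sum.cong[OF refl])
    fix j assume "j \<in> {- int l..int l}"
    then have "real_of_int (int n + j) = real n * (1 + of_int j / real n)"
        "0 \<le> 1 + of_int j / real n"
      using assms by (auto simp: field_simps)
    then have "real_of_int (int n + j) powr a = real n powr a * (1 + of_int j / real n) powr a"
      by (simp only: powr_mult)
    then show "?c j * (1 + of_int j / real n) powr a
        = ?c j * real_of_int (int n + j) powr a / real n powr a"
      using assms by simp
  qed
  finally show ?thesis .
qed

lemma powr_half_integer:
  assumes "p < l" "x \<ge> 0"
  shows "x powr (real l - real p - 1 / 2) = sqrt x * x ^ (l - 1 - p)"
proof (cases "x = 0")
  case False
  have "real l - real p - 1 / 2 = 1 / 2 + real (l - 1 - p)"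
    using assms by (simp add: of_nat_diff)
  then show ?thesis
    using False assms by (simp only: powr_add powr_half_sqrt powr_realpow)
qed auto

text \<open>
  The identity holds at \<open>x = 0\<close> as well, where both sides are 0 since all exponents are positive.
  This matters for \<open>n = l\<close>, where the stencil of the Laplacian reaches 0.
\<close>

lemma g_seq_eq_powr_sum:
  assumes "l \<ge> 1" "x \<ge> 0"
  shows "g_seq l x = (\<Sum>p<l. of_int (stirling_first l (int l - int p))
    * real_of_int x powr (real l - real p - 1 / 2))"
  using assms
  by (simp add: g_seq_def prod_diff_eq_stirling_sum powr_half_integer sum_distrib_left mult_ac del: One_nat_def)

text \<open>
  Normalised so that \<open>powr_ratio l n 0\<close> is the quantity between \<open>\<rho>\<close> and its leading term.
\<close>

definition powr_ratio :: "nat \<Rightarrow> nat \<Rightarrow> nat \<Rightarrow> real" where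
  "powr_ratio l n p =
     neg_laplacian_pow l (\<lambda>i. real_of_int i powr (real l - real p - 1 / 2)) (int n)
       / real n powr (real l - real p - 1 / 2)"

lemma r_term_sums:
  assumes "p < l" "l \<le> n"
  shows "(\<lambda>m. r_term l p m / real n ^ m)
    sums (of_int (stirling_first l (int l - int p)) * powr_ratio l n p)"
proof -
  have "real l - real p - 1 / 2 > 0"
    using assms(1) by linarith
  then have "(\<lambda>m. ((real l - real p - 1 / 2) gchoose m) * X_coeff l m / real n ^ m)
      sums powr_ratio l n p"
    unfolding powr_ratio_def using assms by (intro neg_laplacian_pow_powr_sums) auto
  from sums_mult[OF this, of "of_int (stirling_first l (int l - int p))"] show ?thesis
    by (simp add: r_term_def mult_ac)
qed

text \<open>
  The series for each \<open>p\<close> is shifted by \<open>p\<close> positions, to account for the factor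
  \<open>1 / n ^ p\<close>, and the finitely many shifted series are added.
\<close>

lemma r_coeff_sums:
  assumes "l \<ge> 1" "l \<le> n"
  shows "(\<lambda>k. r_coeff l k / real n ^ k)
    sums (\<Sum>p<l. of_int (stirling_first l (int l - int p)) * powr_ratio l n p / real n ^ p)"
proof -
  have "(\<lambda>k. if p \<le> k then r_term l p (k - p) / real n ^ k else 0)
      sums (of_int (stirling_first l (int l - int p)) * powr_ratio l n p / real n ^ p)"
    if "p < l" for p
  proof -
    have "(\<lambda>m. r_term l p m / real n ^ m / real n ^ p)
        sums (of_int (stirling_first l (int l - int p)) * powr_ratio l n p / real n ^ p)"
      by (intro sums_divide r_term_sums that assms)
    then show ?thesis
      by (subst sums_zero_iff_shift[of p, symmetric]) (auto simp: power_add mult_ac)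
  qed
  then have "(\<lambda>k. \<Sum>p<l. if p \<le> k then r_term l p (k - p) / real n ^ k else 0)
      sums (\<Sum>p<l. of_int (stirling_first l (int l - int p)) * powr_ratio l n p / real n ^ p)"
    by (intro sums_sum) auto
  then show ?thesis
    using assms(1) by (simp add: r_coeff_eq_sum_r_term sum_divide_distrib if_distrib[of "\<lambda>t. t / _"] cong: if_cong)
qed

lemma rho_eq_stirling_sum:
  assumes "l \<ge> 1" "l \<le> n"
  shows "rho l n = real n ^ (l - 1) / (\<Prod>j = 1..l - 1. real n - real j)
    * (\<Sum>p<l. of_int (stirling_first l (int l - int p)) * powr_ratio l n p / real n ^ p)"
proof -
  let ?s = "\<lambda>p. real_of_int (stirling_first l (int l - int p))"
  let ?u = "\<lambda>p i. real_of_int i powr (real l - real p - 1 / 2)"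
  have n: "real n > 0"
    using assms by simp
  have "neg_laplacian_pow l (g_seq l) (int n)
      = neg_laplacian_pow l (\<lambda>i. \<Sum>p<l. ?s p * ?u p i) (int n)"
    unfolding neg_laplacian_pow_def using assms
    by (intro sum.cong refl arg_cong[where f = "(*) _"] g_seq_eq_powr_sum) auto
  also have "\<dots> = (\<Sum>p<l. ?s p * neg_laplacian_pow l (?u p) (int n))"
    by (rule neg_laplacian_pow_sum)
  also have "\<dots> = (\<Sum>p<l. sqrt (real n) * real n ^ (l - 1) * (?s p * powr_ratio l n p / real n ^ p))"
  proof (rule sum.cong[OF refl])
    fix p assume p: "p \<in> {..<l}"
    have "neg_laplacian_pow l (?u p) (int n)
        = real n powr (real l - real p - 1 / 2) * powr_ratio l n p"
      using n by (simp add: powr_ratio_def)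
    also have "real n powr (real l - real p - 1 / 2) = sqrt (real n) * (real n ^ (l - 1) / real n ^ p)"
      using p n by (simp add: powr_half_integer power_diff)
    finally show "?s p * neg_laplacian_pow l (?u p) (int n)
        = sqrt (real n) * real n ^ (l - 1) * (?s p * powr_ratio l n p / real n ^ p)"
      by simp
  qed
  also have "\<dots> = sqrt (real n) * real n ^ (l - 1) * (\<Sum>p<l. ?s p * powr_ratio l n p / real n ^ p)"
    by (simp only: sum_distrib_left)
  finally show ?thesis
    using n by (simp add: rho_def g_seq_def)
qed

lemma rho_expansion:
  assumes "l \<ge> 1" "l \<le> n"
  shows "summable (\<lambda>i. r_coeff l (2 * l + i) / real n ^ (2 * l + i))"
    and "rho l n = real n ^ (l - 1) / (\<Prod>j = 1..l - 1. real n - real j)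
      * (\<Sum>i. r_coeff l (2 * l + i) / real n ^ (2 * l + i))"
proof -
  have "(\<lambda>i. r_coeff l (2 * l + i) / real n ^ (2 * l + i))
    sums (\<Sum>p<l. of_int (stirling_first l (int l - int p)) * powr_ratio l n p / real n ^ p)"
    using sums_zero_iff_shift[of "2 * l" "\<lambda>k. r_coeff l k / real n ^ k"] r_coeff_sums[OF assms]
    by (simp add: r_coeff_def add.commute)
  then show "summable (\<lambda>i. r_coeff l (2 * l + i) / real n ^ (2 * l + i))"
    and "rho l n = real n ^ (l - 1) / (\<Prod>j = 1..l - 1. real n - real j)
      * (\<Sum>i. r_coeff l (2 * l + i) / real n ^ (2 * l + i))"
    by (auto simp: sums_iff rho_eq_stirling_sum[OF assms])
qed

section \<open>The lower bounds\<close>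

lemma powr_ratio_0_sums:
  assumes "l \<ge> 1" "l \<le> n"
  shows "(\<lambda>m. r_term l 0 m / real n ^ m) sums powr_ratio l n 0"
  using r_term_sums[of 0 l n] assms by (simp add: stirling_first_def)

text \<open>
  The series has nonnegative terms, starts with the leading term at \<open>m = 2 * l\<close>, and its term at
  \<open>m = 2 * l + 2\<close> makes the inequality strict.
\<close>

lemma powr_ratio_0_gt_leading:
  assumes "l \<ge> 1" "l \<le> n"
  shows "powr_ratio l n 0 > (pochhammer (1 / 2) l)\<^sup>2 / real n ^ (2 * l)"
proof -
  let ?f = "\<lambda>m. r_term l 0 m / real n ^ m"
  have f: "?f sums powr_ratio l n 0"
    by (rule powr_ratio_0_sums[OF assms])
  have "?f (2 * l) < ?f (2 * l) + ?f (2 * l + 2)"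
    using assms r_term_pos[of 0 l "2 * l + 2"] by simp
  also have "\<dots> = sum ?f {2 * l, 2 * l + 2}"
    by simp
  also have "\<dots> \<le> suminf ?f"
    using assms by (intro sum_le_suminf sums_summable[OF f]) (auto intro!: divide_nonneg_nonneg r_term_nonneg)
  also have "\<dots> = powr_ratio l n 0"
    using f by (simp add: sums_iff)
  finally show ?thesis
    by (simp add: r_term_leading)
qed

text \<open>
  The summands with \<open>p = 0\<close> in \<open>r_coeff l k\<close> bound the series from below by \<open>powr_ratio l n 0\<close>.
  Strictness comes from the prefactor, which exceeds 1 because for \<open>l \<ge> 2\<close> the product is nonempty
  and each of its factors is less than \<open>n\<close>.
\<close>

lemma rho_gt_powr_ratio_0:
  assumes "l \<ge> 2" "l \<le> n"
  shows "rho l n > powr_ratio l n 0"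
proof -
  let ?S = "\<Sum>p<l. of_int (stirling_first l (int l - int p)) * powr_ratio l n p / real n ^ p"
  let ?Q = "\<Prod>j = 1..l - 1. real n - real j"
  have pos: "powr_ratio l n 0 > 0"
    using powr_ratio_0_gt_leading[of l n] assms by (smt (verit) divide_nonneg_nonneg one_le_numeral order_trans of_nat_0_le_iff zero_le_power zero_le_power2)
  have "powr_ratio l n 0 \<le> ?S"
  proof (rule sums_le[OF _ powr_ratio_0_sums r_coeff_sums])
    show "r_term l 0 k / real n ^ k \<le> r_coeff l k / real n ^ k" for k
      using r_term_le_r_coeff[of 0 l k] assms by (intro divide_right_mono) auto
  qed (use assms in auto)
  moreover have "?Q > 0"
    using assms by (intro prod_pos) auto
  moreover have "?Q < real n ^ (l - 1)"
  proof -
    have "?Q < (\<Prod>j = 1..l - 1. real n)"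
      using assms by (intro prod_mono_strict) auto
    then show ?thesis by simp
  qed
  ultimately have "1 * powr_ratio l n 0 < real n ^ (l - 1) / ?Q * ?S"
    using pos by (intro mult_less_le_imp_less) auto
  then show ?thesis
    using rho_eq_stirling_sum[of l n] assms by simp
qed

theorem theorem5:
  fixes l :: nat
  assumes "l \<ge> 1"
  shows
    "(\<forall>n\<ge>l.
        summable (\<lambda>i. r_coeff l (2 * l + i) / real n ^ (2 * l + i)) \<and>
        rho l n = real n ^ (l - 1) / (\<Prod>j = 1..l - 1. real n - real j)
                    * (\<Sum>i. r_coeff l (2 * l + i) / real n ^ (2 * l + i))) \<and>
     r_coeff l (2 * l) = (pochhammer (1 / 2) l)\<^sup>2 \<and>
     r_coeff l (2 * l + 1) =
       real l * (real l - 1) * (2 * real l + 1) / (2 * (2 * real l - 1)) * (pochhammer (1 / 2) l)\<^sup>2 \<and>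
     (l \<ge> 2 \<longrightarrow> (\<forall>k\<ge>2 * l. r_coeff l k > 0)) \<and>
     (l = 1 \<longrightarrow> (\<forall>k\<ge>1. r_coeff l (2 * k + 1) = 0 \<and> r_coeff l (2 * k) > 0)) \<and>
     (l \<ge> 2 \<longrightarrow> (\<forall>n\<ge>l.
        rho l n > neg_laplacian_pow l (\<lambda>i. real_of_int i powr (real l - 1 / 2)) (int n)
                    / real n powr (real l - 1 / 2) \<and>
        neg_laplacian_pow l (\<lambda>i. real_of_int i powr (real l - 1 / 2)) (int n)
                    / real n powr (real l - 1 / 2)
          > (pochhammer (1 / 2) l)\<^sup>2 * (1 / real n ^ (2 * l))))"
proof -
  have series: "\<forall>n\<ge>l.
        summable (\<lambda>i. r_coeff l (2 * l + i) / real n ^ (2 * l + i)) \<and>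
        rho l n = real n ^ (l - 1) / (\<Prod>j = 1..l - 1. real n - real j)
                    * (\<Sum>i. r_coeff l (2 * l + i) / real n ^ (2 * l + i))"
    using rho_expansion[OF assms] by blast
  have one: "l = 1 \<longrightarrow> (\<forall>k\<ge>1. r_coeff l (2 * k + 1) = 0 \<and> r_coeff l (2 * k) > 0)"
    using r_term_pos[of 0 1] r_term_eq_0[of _ 1 0] by (auto simp: r_coeff_one simp del: One_nat_def)
  have bounds: "l \<ge> 2 \<longrightarrow> (\<forall>n\<ge>l.
        rho l n > neg_laplacian_pow l (\<lambda>i. real_of_int i powr (real l - 1 / 2)) (int n)
                    / real n powr (real l - 1 / 2) \<and>
        neg_laplacian_pow l (\<lambda>i. real_of_int i powr (real l - 1 / 2)) (int n)
                    / real n powr (real l - 1 / 2)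
          > (pochhammer (1 / 2) l)\<^sup>2 * (1 / real n ^ (2 * l)))"
    using rho_gt_powr_ratio_0[of l] powr_ratio_0_gt_leading[OF assms]
    by (simp add: powr_ratio_def)
  show ?thesis
    using series r_coeff_leading[OF assms] r_coeff_subleading[OF assms] r_coeff_pos one bounds
    by blast
qed

end
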